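(* Consider the relaxed BDF2 energy quadratization scheme defined in the context, with relaxation parameter $\eta\in[0,1]$, for the quadratized system $\partial_t\Psi=-\mathcal{N}(\Psi)\mathcal{L}\Psi$, $\Psi=(\phi,q)^T$. The scheme is unconditionally energy stable: for every time step $\delta t>0$ (with no restriction on its size), every $\eta\in[0,1]$ and every $n\ge1$, if $\Psi^{n+1}=(\phi^{n+1},q^{n+1})^T$ is produced by the scheme from $\Psi^{n-1}=(\phi^{n-1},q^{n-1})^T$ and $\Psi^n=(\phi^n,q^n)^T$, then $$\frac14\Big[(\phi^{n+1},\mathcal{L}_0\phi^{n+1})+(2\phi^{n+1}-\phi^n,\mathcal{L}_0(2\phi^{n+1}-\phi^n))+\|q^{n+1}\|^2+\|2q^{n+1}-q^n\|^2\Big]$$ $$\le\;\frac14\Big[(\phi^{n},\mathcal{L}_0\phi^{n})+(2\phi^{n}-\phi^{n-1},\mathcal{L}_0(2\phi^{n}-\phi^{n-1}))+\|q^{n}\|^2+\|2q^{n}-q^{n-1}\|^2\Big].$$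
   Context: **Setting.** $\Omega$ is a bounded domain, $(f,g)=\int_\Omega fg\,d\mathbf{x}$ is the $L^2(\Omega)$ inner product (summed over components for vector-valued functions and for pairs such as $\Psi$), and $\|\cdot\|$ is the induced norm. The model is $\partial_t\phi=-\mathcal{G}\frac{\delta\mathcal{E}}{\delta\phi}$ with free energy $\mathcal{E}(\phi)=\int_\Omega e\,d\mathbf{x}$, where $e$ is the energy density. The mobility is $\mathcal{G}=\mathcal{G}_a+\mathcal{G}_s$, with $\mathcal{G}_s$ a symmetric positive semi-definite linear operator and $\mathcal{G}_a$ a skew-symmetric linear operator, both with respect to $(\cdot,\cdot)$. $\mathcal{L}_0$ is a linear operator separated from $e$; it is self-adjoint and positive semi-definite, with square root $\mathcal{L}_0^{1/2}$. Boundary conditions (e.g. periodic) are such that all boundary contributions in integrations by parts vanish, and all functions are regular enough for the expressions below to make sense. **Auxiliary variable.** Put $$q=h(\phi)=\sqrt{2\Big(e-\tfrac12|\mathcal{L}_0^{1/2}\phi|^2+\tfrac{A_0}{|\Omega|}\Big)},$$ where $A_0>0$ is a constant such that $h(\phi)$ is a well-defined real function. It is assumed that $q=q(\phi,\nabla\phi)$, and we write $g(\phi)=\frac{\partial q}{\partial\phi}$ and $\mathbf{G}(\nabla\phi)=\frac{\partial q}{\partial\nabla\phi}$. **Quadratized system.** The model is rewritten as $$\partial_t\phi=-(\mathcal{G}_a+\mathcal{G}_s)\big[\mathcal{L}_0\phi+q\,g(\phi)-\nabla\cdot(q\,\mathbf{G}(\nabla\phi))\big],\qquad \partial_t q=g(\phi)\,\partial_t\phi+\mathbf{G}(\nabla\phi):\nabla\partial_t\phi.$$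 In compact form, with $\Psi=(\phi,q)^T$, this is $\partial_t\Psi=-\mathcal{N}(\Psi)\mathcal{L}\Psi$, where $$\mathcal{L}=\begin{bmatrix}\mathcal{L}_0&0\\ 0&1\end{bmatrix},\qquad \mathcal{N}(\Psi)=\mathcal{N}_0^*(\mathcal{G}_a+\mathcal{G}_s)\mathcal{N}_0.$$ Here $\mathcal{N}_0=\mathcal{N}_0(\Psi)$ and $\mathcal{N}_0^*$ are mutually adjoint, given by $$\mathcal{N}_0^*v=\begin{bmatrix}v\\ g(\phi)v+\mathbf{G}(\nabla\phi):\nabla v\end{bmatrix},\qquad \mathcal{N}_0\begin{bmatrix}u\\ p\end{bmatrix}=u+g(\phi)p-\nabla\cdot(p\,\mathbf{G}(\nabla\phi)).$$ **Relaxed BDF2 scheme.** Let $\delta t>0$ and $\eta\in[0,1]$. Given $\Psi^{n-1}=(\phi^{n-1},q^{n-1})^T$ and $\Psi^n=(\phi^n,q^n)^T$, set $\overline{\Psi}^{n+1}=2\Psi^n-\Psi^{n-1}$. Step 1: find $\hat\Psi^{n+1}=(\phi^{n+1},\hat q^{n+1})^T$ such that $$\frac{3\hat\Psi^{n+1}-4\Psi^n+\Psi^{n-1}}{2\delta t}=-\mathcal{N}(\overline\Psi^{n+1})\,\mathcal{L}\hat\Psi^{n+1}.$$ Step 2: set $q^{n+1}=\xi_0\hat q^{n+1}+(1-\xi_0)h(\phi^{n+1})$ with $$\xi_0=\max\Big\{0,\frac{-b-\sqrt{b^2-4ac}}{2a}\Big\},$$ where $$a=\tfrac54\|\hat q^{n+1}-h(\phi^{n+1})\|^2,$$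 $$b=\tfrac12\big(\hat q^{n+1}-h(\phi^{n+1}),h(\phi^{n+1})\big)+\big(\hat q^{n+1}-h(\phi^{n+1}),2h(\phi^{n+1})-q^n\big),$$ $$c=\tfrac14\Big[\|h(\phi^{n+1})\|^2+\|2h(\phi^{n+1})-q^n\|^2-\|\hat q^{n+1}\|^2-\|2\hat q^{n+1}-q^n\|^2\Big]-\delta t\,\eta\,\big(\mathcal{L}\hat\Psi^{n+1},\mathcal{N}(\overline\Psi^{n+1})\mathcal{L}\hat\Psi^{n+1}\big).$$ If $a=0$, i.e. $\hat q^{n+1}=h(\phi^{n+1})$, the value of $\xi_0$ is immaterial and $q^{n+1}=\hat q^{n+1}=h(\phi^{n+1})$. The new iterate is $\Psi^{n+1}=(\phi^{n+1},q^{n+1})^T$. *)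

theory Defs
  imports "HOL-Analysis.Analysis"
begin

section \<open>The space L2 and linear operators on function spaces\<close>

text \<open>Functions are total, but are only examined on \<open>\<Omega>\<close>. Equality in L2 is equality almost
  everywhere on \<open>\<Omega>\<close>. On pairs, the library inner product is the sum over the components.\<close>

definition L2_functions :: "(real^'d) set \<Rightarrow> (real^'d \<Rightarrow> 'b::euclidean_space) set" where
  "L2_functions \<Omega> = {f. f \<in> borel_measurable (lebesgue_on \<Omega>) \<and>
                        integrable (lebesgue_on \<Omega>) (\<lambda>x. f x \<bullet> f x)}"

definition L2_inner ::
    "(real^'d) set \<Rightarrow> (real^'d \<Rightarrow> 'b::euclidean_space) \<Rightarrow> (real^'d \<Rightarrow> 'b) \<Rightarrow> real" where
  "L2_inner \<Omega> f g = (LINT x|lebesgue_on \<Omega>. f x \<bullet> g x)"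

definition L2_norm :: "(real^'d) set \<Rightarrow> (real^'d \<Rightarrow> 'b::euclidean_space) \<Rightarrow> real" where
  "L2_norm \<Omega> f = sqrt (L2_inner \<Omega> f f)"

definition L2_subspace :: "(real^'d) set \<Rightarrow> (real^'d \<Rightarrow> 'b::euclidean_space) set \<Rightarrow> bool" where
  "L2_subspace \<Omega> D \<longleftrightarrow> D \<subseteq> L2_functions \<Omega> \<and> (\<lambda>x. 0) \<in> D \<and>
     (\<forall>u\<in>D. \<forall>v\<in>D. \<forall>r s. (\<lambda>x. r *\<^sub>R u x + s *\<^sub>R v x) \<in> D)"

text \<open>Possibly unbounded linear operators \<open>T\<close> with domain \<open>D\<close>.\<close>

definition linear_operator ::
    "(real^'d) set \<Rightarrow> (real^'d \<Rightarrow> 'b::euclidean_space) set \<Rightarrow>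
     ((real^'d \<Rightarrow> 'b) \<Rightarrow> (real^'d \<Rightarrow> 'b)) \<Rightarrow> bool" where
  "linear_operator \<Omega> D T \<longleftrightarrow> L2_subspace \<Omega> D \<and> (\<forall>u\<in>D. T u \<in> L2_functions \<Omega>) \<and>
     (\<forall>u\<in>D. \<forall>v\<in>D. \<forall>r s. AE x in lebesgue_on \<Omega>.
        T (\<lambda>y. r *\<^sub>R u y + s *\<^sub>R v y) x = r *\<^sub>R T u x + s *\<^sub>R T v x)"

definition symmetric_on ::
    "(real^'d) set \<Rightarrow> (real^'d \<Rightarrow> 'b::euclidean_space) set \<Rightarrow>
     ((real^'d \<Rightarrow> 'b) \<Rightarrow> (real^'d \<Rightarrow> 'b)) \<Rightarrow> bool" where
  "symmetric_on \<Omega> D T \<longleftrightarrow> (\<forall>u\<in>D. \<forall>v\<in>D. L2_inner \<Omega> (T u) v = L2_inner \<Omega> u (T v))"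

definition skew_symmetric_on ::
    "(real^'d) set \<Rightarrow> (real^'d \<Rightarrow> 'b::euclidean_space) set \<Rightarrow>
     ((real^'d \<Rightarrow> 'b) \<Rightarrow> (real^'d \<Rightarrow> 'b)) \<Rightarrow> bool" where
  "skew_symmetric_on \<Omega> D T \<longleftrightarrow> (\<forall>u\<in>D. \<forall>v\<in>D. L2_inner \<Omega> (T u) v = - L2_inner \<Omega> u (T v))"

definition pos_semidef_on ::
    "(real^'d) set \<Rightarrow> (real^'d \<Rightarrow> 'b::euclidean_space) set \<Rightarrow>
     ((real^'d \<Rightarrow> 'b) \<Rightarrow> (real^'d \<Rightarrow> 'b)) \<Rightarrow> bool" where
  "pos_semidef_on \<Omega> D T \<longleftrightarrow> (\<forall>u\<in>D. 0 \<le> L2_inner \<Omega> (T u) u)"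


section \<open>Differential operators\<close>

text \<open>A tensor with \<open>m\<close> rows and \<open>d\<close> columns has type \<open>real^'d^'m\<close>; the library inner product on
  this type is the contraction \<open>A : B\<close>, and the gradient of a field is its Jacobian matrix.\<close>

abbreviation gradient_field :: "(real^'d \<Rightarrow> real^'m) \<Rightarrow> real^'d \<Rightarrow> real^'d^'m" where
  "gradient_field v x \<equiv> jacobian v (at x)"

definition divergence :: "(real^'d \<Rightarrow> real^'d) \<Rightarrow> real^'d \<Rightarrow> real" where
  "divergence F x = trace (jacobian F (at x))"

definition tensor_divergence :: "(real^'d \<Rightarrow> real^'d^'m) \<Rightarrow> real^'d \<Rightarrow> real^'m" where
  "tensor_divergence T x = (\<chi> i. divergence (\<lambda>y. T y $ i) x)"

text \<open>The derivative of a scalar function with respect to a vector or tensor argument.\<close>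

definition scalar_gradient :: "('b::real_inner \<Rightarrow> real) \<Rightarrow> 'b \<Rightarrow> 'b" where
  "scalar_gradient F u = (THE D. GDERIV F u :> D)"


section \<open>The model\<close>

text \<open>Data of the model. \<open>states\<close> is the space of admissible fields \<open>\<phi>\<close> (sufficiently regular and
  subject to the boundary conditions), which is also the domain of \<open>L0\<close>; \<open>aux\<close> is the corresponding
  class of auxiliary variables \<open>q\<close>; \<open>mob_dom\<close> is the domain of the mobility; \<open>root_dom\<close> is the domain
  of the square root \<open>rootL0\<close>. \<open>edens \<phi> x\<close> is the energy density of the state \<open>\<phi>\<close> at the
  point \<open>x\<close>; it may depend on \<open>\<phi>\<close> in any way. \<open>qfun\<close> is \<open>q\<close> as a function of the values of \<open>\<phi>\<close>
  and \<open>\<nabla>\<phi>\<close>.\<close>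

record ('d, 'm) eq_data =
  Omega :: "(real^'d) set"
  states :: "(real^'d \<Rightarrow> real^'m) set"
  aux :: "(real^'d \<Rightarrow> real) set"
  L0 :: "(real^'d \<Rightarrow> real^'m) \<Rightarrow> (real^'d \<Rightarrow> real^'m)"
  root_dom :: "(real^'d \<Rightarrow> real^'m) set"
  rootL0 :: "(real^'d \<Rightarrow> real^'m) \<Rightarrow> (real^'d \<Rightarrow> real^'m)"
  mob_dom :: "(real^'d \<Rightarrow> real^'m) set"
  Ga :: "(real^'d \<Rightarrow> real^'m) \<Rightarrow> (real^'d \<Rightarrow> real^'m)"
  Gs :: "(real^'d \<Rightarrow> real^'m) \<Rightarrow> (real^'d \<Rightarrow> real^'m)"
  edens :: "(real^'d \<Rightarrow> real^'m) \<Rightarrow> real^'d \<Rightarrow> real"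
  A0 :: real
  qfun :: "real^'m \<Rightarrow> real^'d^'m \<Rightarrow> real"

definition h_radicand :: "('d::finite, 'm::finite) eq_data \<Rightarrow> (real^'d \<Rightarrow> real^'m) \<Rightarrow> real^'d \<Rightarrow> real"
  where "h_radicand M \<phi> x =
    2 * (edens M \<phi> x - (1/2) * (norm (rootL0 M \<phi> x))\<^sup>2 + A0 M / measure lebesgue (Omega M))"

definition h :: "('d::finite, 'm::finite) eq_data \<Rightarrow> (real^'d \<Rightarrow> real^'m) \<Rightarrow> real^'d \<Rightarrow> real" where
  "h M \<phi> x = sqrt (h_radicand M \<phi> x)"

definition g_fun :: "('d::finite, 'm::finite) eq_data \<Rightarrow> (real^'d \<Rightarrow> real^'m) \<Rightarrow> real^'d \<Rightarrow> real^'m" where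
  "g_fun M \<phi> x = scalar_gradient (\<lambda>u. qfun M u (gradient_field \<phi> x)) (\<phi> x)"

definition G_fun :: "('d::finite, 'm::finite) eq_data \<Rightarrow> (real^'d \<Rightarrow> real^'m) \<Rightarrow> real^'d \<Rightarrow> real^'d^'m" where
  "G_fun M \<phi> x = scalar_gradient (\<lambda>P. qfun M (\<phi> x) P) (gradient_field \<phi> x)"

definition flux ::
    "('d::finite, 'm::finite) eq_data \<Rightarrow> (real^'d \<Rightarrow> real^'m) \<Rightarrow> (real^'d \<Rightarrow> real) \<Rightarrow> real^'d \<Rightarrow> real^'d^'m"
  where "flux M \<phi> p x = p x *\<^sub>R G_fun M \<phi> x"

definition mobility ::
    "('d::finite, 'm::finite) eq_data \<Rightarrow> (real^'d \<Rightarrow> real^'m) \<Rightarrow> real^'d \<Rightarrow> real^'m" where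
  "mobility M u x = Ga M u x + Gs M u x"

text \<open>In the last clause below, by the divergence theorem, the integral of \<open>div (T\<^sup>t v)\<close> is the boundary
  integral of \<open>v \<bullet> T n\<close> (\<open>n\<close> the outer unit normal), i.e. the boundary contribution that arises when
  the integral of \<open>(div T) \<bullet> v\<close> is integrated by parts.\<close>

definition eq_model :: "('d::finite, 'm::finite) eq_data \<Rightarrow> bool" where
  "eq_model M \<longleftrightarrow>
     open (Omega M) \<and> connected (Omega M) \<and> bounded (Omega M) \<and> Omega M \<noteq> {} \<and>
     (\<forall>\<phi>\<in>states M. \<forall>x\<in>Omega M. \<phi> differentiable (at x)) \<and>
     aux M \<subseteq> L2_functions (Omega M) \<and>
     \<comment> \<open>the linear part and its square root\<close>
     linear_operator (Omega M) (states M) (L0 M) \<and>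
     symmetric_on (Omega M) (states M) (L0 M) \<and>
     pos_semidef_on (Omega M) (states M) (L0 M) \<and>
     linear_operator (Omega M) (root_dom M) (rootL0 M) \<and>
     symmetric_on (Omega M) (root_dom M) (rootL0 M) \<and>
     pos_semidef_on (Omega M) (root_dom M) (rootL0 M) \<and>
     states M \<subseteq> root_dom M \<and>
     (\<forall>\<phi>\<in>states M. rootL0 M \<phi> \<in> root_dom M \<and>
        (AE x in lebesgue_on (Omega M). rootL0 M (rootL0 M \<phi>) x = L0 M \<phi> x)) \<and>
     \<comment> \<open>the mobility\<close>
     linear_operator (Omega M) (mob_dom M) (Ga M) \<and>
     skew_symmetric_on (Omega M) (mob_dom M) (Ga M) \<and>
     linear_operator (Omega M) (mob_dom M) (Gs M) \<and>
     symmetric_on (Omega M) (mob_dom M) (Gs M) \<and>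
     pos_semidef_on (Omega M) (mob_dom M) (Gs M) \<and>
     \<comment> \<open>the energy and the auxiliary variable\<close>
     (\<forall>\<phi>\<in>states M. integrable (lebesgue_on (Omega M)) (edens M \<phi>)) \<and>
     A0 M > 0 \<and>
     (\<forall>\<phi>\<in>states M. AE x in lebesgue_on (Omega M). 0 \<le> h_radicand M \<phi> x) \<and>
     (\<forall>\<phi>\<in>states M. AE x in lebesgue_on (Omega M).
        h M \<phi> x = qfun M (\<phi> x) (gradient_field \<phi> x)) \<and>
     (\<forall>\<phi>\<in>states M. \<forall>x\<in>Omega M.
        (\<lambda>u. qfun M u (gradient_field \<phi> x)) differentiable (at (\<phi> x)) \<and>
        (\<lambda>P. qfun M (\<phi> x) P) differentiable (at (gradient_field \<phi> x))) \<and>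
     \<comment> \<open>regularity of the fluxes, and vanishing boundary contributions\<close>
     (\<forall>\<phi>\<in>states M. \<forall>p\<in>aux M. \<forall>x\<in>Omega M. flux M \<phi> p differentiable (at x)) \<and>
     (\<forall>\<phi>\<in>states M. \<forall>p\<in>aux M. \<forall>v\<in>states M.
        has_bochner_integral (lebesgue_on (Omega M))
          (divergence (\<lambda>y. transpose (flux M \<phi> p y) *v v y)) 0)"


section \<open>The quadratized system\<close>

abbreviation pair_fun :: "('x \<Rightarrow> 'a) \<Rightarrow> ('x \<Rightarrow> 'b) \<Rightarrow> 'x \<Rightarrow> 'a \<times> 'b" where
  "pair_fun \<phi> q \<equiv> (\<lambda>x. (\<phi> x, q x))"

abbreviation phi_part :: "('x \<Rightarrow> 'a \<times> 'b) \<Rightarrow> 'x \<Rightarrow> 'a" where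
  "phi_part \<Psi> \<equiv> (\<lambda>x. fst (\<Psi> x))"

abbreviation q_part :: "('x \<Rightarrow> 'a \<times> 'b) \<Rightarrow> 'x \<Rightarrow> 'b" where
  "q_part \<Psi> \<equiv> (\<lambda>x. snd (\<Psi> x))"

definition L_op ::
    "('d::finite, 'm::finite) eq_data \<Rightarrow> (real^'d \<Rightarrow> (real^'m) \<times> real) \<Rightarrow> (real^'d \<Rightarrow> (real^'m) \<times> real)" where
  "L_op M \<Psi> = pair_fun (L0 M (phi_part \<Psi>)) (q_part \<Psi>)"

definition N0_op ::
    "('d::finite, 'm::finite) eq_data \<Rightarrow> (real^'d \<Rightarrow> (real^'m) \<times> real) \<Rightarrow>
     (real^'d \<Rightarrow> (real^'m) \<times> real) \<Rightarrow> (real^'d \<Rightarrow> real^'m)" where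
  "N0_op M \<Psi> U = (\<lambda>x. phi_part U x + q_part U x *\<^sub>R g_fun M (phi_part \<Psi>) x
                      - tensor_divergence (flux M (phi_part \<Psi>) (q_part U)) x)"

definition N0_adj ::
    "('d::finite, 'm::finite) eq_data \<Rightarrow> (real^'d \<Rightarrow> (real^'m) \<times> real) \<Rightarrow>
     (real^'d \<Rightarrow> real^'m) \<Rightarrow> (real^'d \<Rightarrow> (real^'m) \<times> real)" where
  "N0_adj M \<Psi> v = (\<lambda>x. (v x, g_fun M (phi_part \<Psi>) x \<bullet> v x
                             + G_fun M (phi_part \<Psi>) x \<bullet> gradient_field v x))"

definition N_op ::
    "('d::finite, 'm::finite) eq_data \<Rightarrow> (real^'d \<Rightarrow> (real^'m) \<times> real) \<Rightarrow>
     (real^'d \<Rightarrow> (real^'m) \<times> real) \<Rightarrow> (real^'d \<Rightarrow> (real^'m) \<times> real)" where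
  "N_op M \<Psi> U = N0_adj M \<Psi> (mobility M (N0_op M \<Psi> U))"


section \<open>The relaxed BDF2 scheme\<close>

definition extrapolate :: "('x \<Rightarrow> 'a::real_vector) \<Rightarrow> ('x \<Rightarrow> 'a) \<Rightarrow> 'x \<Rightarrow> 'a" where
  "extrapolate \<Psi>\<^sub>0 \<Psi>\<^sub>1 = (\<lambda>x. 2 *\<^sub>R \<Psi>\<^sub>1 x - \<Psi>\<^sub>0 x)"

text \<open>In the following, \<open>\<Psi>\<^sub>0\<close>, \<open>\<Psi>\<^sub>1\<close> are the two given iterates (old and current) and \<open>\<Psi>h\<close> is the
  intermediate solution of the first step. The clauses on \<open>mob_dom\<close> and on the mobility say that the
  right-hand side of the equation is meaningful.\<close>

definition bdf2_step1 ::
    "('d::finite, 'm::finite) eq_data \<Rightarrow> real \<Rightarrow> (real^'d \<Rightarrow> (real^'m) \<times> real) \<Rightarrow>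
     (real^'d \<Rightarrow> (real^'m) \<times> real) \<Rightarrow> (real^'d \<Rightarrow> (real^'m) \<times> real) \<Rightarrow> bool" where
  "bdf2_step1 M \<delta>t \<Psi>\<^sub>0 \<Psi>\<^sub>1 \<Psi>h \<longleftrightarrow>
     phi_part \<Psi>h \<in> states M \<and> q_part \<Psi>h \<in> aux M \<and>
     N0_op M (extrapolate \<Psi>\<^sub>0 \<Psi>\<^sub>1) (L_op M \<Psi>h) \<in> mob_dom M \<and>
     mobility M (N0_op M (extrapolate \<Psi>\<^sub>0 \<Psi>\<^sub>1) (L_op M \<Psi>h)) \<in> states M \<and>
     (AE x in lebesgue_on (Omega M).
        (1 / (2 * \<delta>t)) *\<^sub>R (3 *\<^sub>R \<Psi>h x - 4 *\<^sub>R \<Psi>\<^sub>1 x + \<Psi>\<^sub>0 x)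
        = - N_op M (extrapolate \<Psi>\<^sub>0 \<Psi>\<^sub>1) (L_op M \<Psi>h) x)"

definition relax_a ::
    "('d::finite, 'm::finite) eq_data \<Rightarrow> (real^'d \<Rightarrow> (real^'m) \<times> real) \<Rightarrow> real" where
  "relax_a M \<Psi>h = 5/4 * (L2_norm (Omega M) (\<lambda>x. q_part \<Psi>h x - h M (phi_part \<Psi>h) x))\<^sup>2"

definition relax_b ::
    "('d::finite, 'm::finite) eq_data \<Rightarrow> (real^'d \<Rightarrow> (real^'m) \<times> real) \<Rightarrow>
     (real^'d \<Rightarrow> (real^'m) \<times> real) \<Rightarrow> real" where
  "relax_b M \<Psi>\<^sub>1 \<Psi>h =
     (let hn = h M (phi_part \<Psi>h); d = (\<lambda>x. q_part \<Psi>h x - hn x) in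
      1/2 * L2_inner (Omega M) d hn + L2_inner (Omega M) d (\<lambda>x. 2 * hn x - q_part \<Psi>\<^sub>1 x))"

definition relax_c ::
    "('d::finite, 'm::finite) eq_data \<Rightarrow> real \<Rightarrow> real \<Rightarrow> (real^'d \<Rightarrow> (real^'m) \<times> real) \<Rightarrow>
     (real^'d \<Rightarrow> (real^'m) \<times> real) \<Rightarrow> (real^'d \<Rightarrow> (real^'m) \<times> real) \<Rightarrow> real" where
  "relax_c M \<delta>t \<eta> \<Psi>\<^sub>0 \<Psi>\<^sub>1 \<Psi>h =
     (let hn = h M (phi_part \<Psi>h) in
      1/4 * ((L2_norm (Omega M) hn)\<^sup>2 + (L2_norm (Omega M) (\<lambda>x. 2 * hn x - q_part \<Psi>\<^sub>1 x))\<^sup>2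
             - (L2_norm (Omega M) (q_part \<Psi>h))\<^sup>2
             - (L2_norm (Omega M) (\<lambda>x. 2 * q_part \<Psi>h x - q_part \<Psi>\<^sub>1 x))\<^sup>2)
      - \<delta>t * \<eta> * L2_inner (Omega M) (L_op M \<Psi>h)
                   (N_op M (extrapolate \<Psi>\<^sub>0 \<Psi>\<^sub>1) (L_op M \<Psi>h)))"

text \<open>If \<open>a = 0\<close> then the intermediate \<open>q\<close> equals \<open>h\<close> almost everywhere and the value of
  \<open>relax_xi\<close> (which is then \<open>0\<close>, by the convention \<open>x / 0 = 0\<close>) does not matter.\<close>

definition relax_xi ::
    "('d::finite, 'm::finite) eq_data \<Rightarrow> real \<Rightarrow> real \<Rightarrow> (real^'d \<Rightarrow> (real^'m) \<times> real) \<Rightarrow>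
     (real^'d \<Rightarrow> (real^'m) \<times> real) \<Rightarrow> (real^'d \<Rightarrow> (real^'m) \<times> real) \<Rightarrow> real" where
  "relax_xi M \<delta>t \<eta> \<Psi>\<^sub>0 \<Psi>\<^sub>1 \<Psi>h =
     (let a = relax_a M \<Psi>h; b = relax_b M \<Psi>\<^sub>1 \<Psi>h; c = relax_c M \<delta>t \<eta> \<Psi>\<^sub>0 \<Psi>\<^sub>1 \<Psi>h in
      max 0 ((- b - sqrt (b\<^sup>2 - 4 * a * c)) / (2 * a)))"

definition relaxed_bdf2 ::
    "('d::finite, 'm::finite) eq_data \<Rightarrow> real \<Rightarrow> real \<Rightarrow> (real^'d \<Rightarrow> (real^'m) \<times> real) \<Rightarrow>
     (real^'d \<Rightarrow> (real^'m) \<times> real) \<Rightarrow> (real^'d \<Rightarrow> (real^'m) \<times> real) \<Rightarrow> bool" where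
  "relaxed_bdf2 M \<delta>t \<eta> \<Psi>\<^sub>0 \<Psi>\<^sub>1 \<Psi>\<^sub>2 \<longleftrightarrow>
     phi_part \<Psi>\<^sub>0 \<in> states M \<and> q_part \<Psi>\<^sub>0 \<in> L2_functions (Omega M) \<and>
     phi_part \<Psi>\<^sub>1 \<in> states M \<and> q_part \<Psi>\<^sub>1 \<in> L2_functions (Omega M) \<and>
     (\<exists>qh. let \<Psi>h = pair_fun (phi_part \<Psi>\<^sub>2) qh; \<xi> = relax_xi M \<delta>t \<eta> \<Psi>\<^sub>0 \<Psi>\<^sub>1 \<Psi>h in
        bdf2_step1 M \<delta>t \<Psi>\<^sub>0 \<Psi>\<^sub>1 \<Psi>h \<and>
        (AE x in lebesgue_on (Omega M).
           q_part \<Psi>\<^sub>2 x = \<xi> * qh x + (1 - \<xi>) * h M (phi_part \<Psi>\<^sub>2) x))"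

end

theory Submission
  imports Defs
begin

text \<open>Integration by parts makes \<open>N0_adj\<close> the adjoint of \<open>N0_op\<close>, so with \<open>w = N0_op (L \<Psi>h)\<close> the
  dissipation \<open>D = (L \<Psi>h, N (L \<Psi>h))\<close> equals \<open>(w, (Ga + Gs) w) = (w, Gs w) \<ge> 0\<close>. Testing the first step
  with \<open>L \<Psi>h\<close>, the BDF2 identity shows that the energy of the intermediate solution has dropped by at
  least \<open>\<delta>t * D\<close>. In the second step the energy is a quadratic polynomial in \<open>\<xi>\<close>: it exceeds the
  intermediate energy plus \<open>\<delta>t * \<eta> * D\<close> by exactly \<open>a * \<xi>^2 + b * \<xi> + c\<close>. At \<open>\<xi> = 1\<close> this is
  \<open>- \<delta>t * \<eta> * D \<le> 0\<close>, so the polynomial is not positive at \<open>relax_xi\<close>, and the relaxation gives back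
  at most the fraction \<open>\<eta> \<le> 1\<close> of the dissipated energy.\<close>

section \<open>L2 functions on a Lebesgue measurable set\<close>

text \<open>Completeness is what makes L2 membership invariant under changes on a null set; this
  matters because the scheme prescribes the new auxiliary variable only almost everywhere.\<close>

lemma complete_measure_lebesgue_on:
  assumes "S \<in> sets lebesgue"
  shows "complete_measure (lebesgue_on S)"
proof
  fix A B assume "A \<subseteq> B" "B \<in> null_sets (lebesgue_on S)"
  then have "B \<in> null_sets lebesgue" "B \<subseteq> S"
    using assms by (simp_all add: null_sets_restrict_space)
  then have "A \<in> sets lebesgue"
    using \<open>A \<subseteq> B\<close> completion.complete by blast
  then show "A \<in> sets (lebesgue_on S)"
    using \<open>A \<subseteq> B\<close> \<open>B \<subseteq> S\<close> assms by (simp add: sets_restrict_space_iff)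
qed

text \<open>The preimages of a set under \<open>f\<close> and \<open>g\<close> differ by a subset of
  a null set, and completeness makes such a subset measurable.\<close>

lemma (in complete_measure) measurable_cong_AE:
  assumes "f \<in> measurable M N" "AE x in M. f x = g x" "g \<in> space M \<rightarrow> space N"
  shows "g \<in> measurable M N"
proof (rule measurableI)
  fix A assume "A \<in> sets N"
  show "g -` A \<inter> space M \<in> sets M"
  proof (rule in_sets_AE)
    show "f -` A \<inter> space M \<in> sets M"
      using assms(1) \<open>A \<in> sets N\<close> by (rule measurable_sets)
    show "AE x in M. x \<in> f -` A \<inter> space M \<longleftrightarrow> x \<in> g -` A \<inter> space M"
      using assms(2) by eventually_elim auto
  qed simp
qed (use assms in auto)

lemma integrable_inner_L2_functions:
  assumes "f \<in> L2_functions \<Omega>" "g \<in> L2_functions \<Omega>"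
  shows "integrable (lebesgue_on \<Omega>) (\<lambda>x. f x \<bullet> g x)"
proof (rule Bochner_Integration.integrable_bound)
  show "integrable (lebesgue_on \<Omega>) (\<lambda>x. f x \<bullet> f x + g x \<bullet> g x)"
    using assms by (simp add: L2_functions_def)
  show "(\<lambda>x. f x \<bullet> g x) \<in> borel_measurable (lebesgue_on \<Omega>)"
    using assms by (intro borel_measurable_inner) (simp_all add: L2_functions_def)
  \<comment> \<open>Young's inequality without its factor 1/2, from expanding the squares of
    \<open>a + b\<close> and \<open>a - b\<close>.\<close>
  have "\<bar>a \<bullet> b\<bar> \<le> a \<bullet> a + b \<bullet> b" for a b :: 'b
  proof -
    have "0 \<le> (a + b) \<bullet> (a + b)" "0 \<le> (a - b) \<bullet> (a - b)" "0 \<le> a \<bullet> a" "0 \<le> b \<bullet> b"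
      by simp_all
    then show ?thesis
      by (simp add: inner_add_left inner_add_right inner_diff_left inner_diff_right inner_commute)
  qed
  then show "AE x in lebesgue_on \<Omega>. norm (f x \<bullet> g x) \<le> norm (f x \<bullet> f x + g x \<bullet> g x)"
    by (auto simp: abs_of_nonneg)
qed

lemma L2_subspace_L2_functions:
  "L2_subspace \<Omega> (L2_functions \<Omega> :: (real^'d \<Rightarrow> 'b::euclidean_space) set)"
  unfolding L2_subspace_def
proof (intro conjI ballI allI)
  fix u v :: "real^'d \<Rightarrow> 'b" and r s :: real
  assume uv: "u \<in> L2_functions \<Omega>" "v \<in> L2_functions \<Omega>"
  have "integrable (lebesgue_on \<Omega>) (\<lambda>x. (r * r) * (u x \<bullet> u x) + (2 * r * s) * (u x \<bullet> v x) + (s * s) * (v x \<bullet> v x))"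
    using uv by (intro Bochner_Integration.integrable_add integrable_mult_right integrable_inner_L2_functions)
  moreover have "(\<lambda>x. r *\<^sub>R u x + s *\<^sub>R v x) \<in> borel_measurable (lebesgue_on \<Omega>)"
    using uv by (auto simp: L2_functions_def intro!: borel_measurable_add borel_measurable_scaleR)
  ultimately show "(\<lambda>x. r *\<^sub>R u x + s *\<^sub>R v x) \<in> L2_functions \<Omega>"
    by (simp add: L2_functions_def inner_add_left inner_add_right inner_commute algebra_simps)
qed (auto simp: L2_functions_def)

lemma L2_subspace_lincomb:
  "L2_subspace \<Omega> D \<Longrightarrow> u \<in> D \<Longrightarrow> v \<in> D \<Longrightarrow> (\<lambda>x. r *\<^sub>R u x + s *\<^sub>R v x) \<in> D"
  unfolding L2_subspace_def by blast

lemma linear_operatorD: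
  assumes "linear_operator \<Omega> D T"
  shows "L2_subspace \<Omega> D"
    and "u \<in> D \<Longrightarrow> u \<in> L2_functions \<Omega>"
    and "u \<in> D \<Longrightarrow> T u \<in> L2_functions \<Omega>"
  using assms unfolding linear_operator_def L2_subspace_def by auto

lemma L2_inner_commute: "L2_inner \<Omega> f g = L2_inner \<Omega> g f"
  by (simp add: L2_inner_def inner_commute)

lemma L2_inner_nonneg: "0 \<le> L2_inner \<Omega> f f"
  by (simp add: L2_inner_def)

lemma L2_norm_power2: "(L2_norm \<Omega> f)\<^sup>2 = L2_inner \<Omega> f f"
  by (simp add: L2_norm_def L2_inner_nonneg)

lemma L2_inner_lincomb_left:
  assumes "u \<in> L2_functions \<Omega>" "v \<in> L2_functions \<Omega>" "w \<in> L2_functions \<Omega>"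
  shows "L2_inner \<Omega> (\<lambda>x. r *\<^sub>R u x + s *\<^sub>R v x) w = r * L2_inner \<Omega> u w + s * L2_inner \<Omega> v w"
  using assms by (simp add: L2_inner_def inner_add_left integrable_inner_L2_functions)

lemma L2_functions_cong_AE:
  assumes "\<Omega> \<in> sets lebesgue" "f \<in> L2_functions \<Omega>" "AE x in lebesgue_on \<Omega>. f x = g x"
  shows "g \<in> L2_functions \<Omega>"
proof -
  have f: "f \<in> borel_measurable (lebesgue_on \<Omega>)" "integrable (lebesgue_on \<Omega>) (\<lambda>x. f x \<bullet> f x)"
    using assms(2) by (auto simp: L2_functions_def)
  have g: "g \<in> borel_measurable (lebesgue_on \<Omega>)"
    using complete_measure.measurable_cong_AE[OF complete_measure_lebesgue_on[OF assms(1)] f(1) assms(3)]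
    by simp
  have "AE x in lebesgue_on \<Omega>. f x \<bullet> f x = g x \<bullet> g x"
    using assms(3) by eventually_elim simp
  then have "integrable (lebesgue_on \<Omega>) (\<lambda>x. g x \<bullet> g x)"
    using g by (intro integrable_cong_AE_imp[OF f(2)]) auto
  with g show ?thesis
    by (simp add: L2_functions_def)
qed

lemma L2_inner_cong_AE:
  assumes "f \<in> L2_functions \<Omega>" "f' \<in> L2_functions \<Omega>" "g \<in> L2_functions \<Omega>" "g' \<in> L2_functions \<Omega>"
    and "AE x in lebesgue_on \<Omega>. f x = f' x" "AE x in lebesgue_on \<Omega>. g x = g' x"
  shows "L2_inner \<Omega> f g = L2_inner \<Omega> f' g'"
  unfolding L2_inner_def
proof (rule integral_cong_AE)
  show "AE x in lebesgue_on \<Omega>. f x \<bullet> g x = f' x \<bullet> g' x"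
    using assms(5,6) by eventually_elim simp
qed (use assms in \<open>auto simp: L2_functions_def\<close>)

section \<open>Algebra of the scheme\<close>

text \<open>The discrete counterpart of 2 (u', u) = (|u|^2)' for the BDF2 difference (G-stability):
  a difference of two-level energies plus the square of a second difference, which acts as numerical
  dissipation. The form \<open>B\<close> is abstract because the identity is applied twice, once to
  (u, L0 v) on \<open>states M\<close> and once to the L2 inner product.\<close>

lemma bdf2_identity:
  fixes B :: "('x \<Rightarrow> 'b::real_vector) \<Rightarrow> ('x \<Rightarrow> 'b) \<Rightarrow> real"
  assumes closed: "\<And>u v r s. u \<in> D \<Longrightarrow> v \<in> D \<Longrightarrow> (\<lambda>x. r *\<^sub>R u x + s *\<^sub>R v x) \<in> D"
    and linear: "\<And>u v w r s. u \<in> D \<Longrightarrow> v \<in> D \<Longrightarrow> w \<in> D \<Longrightarrow>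
           B (\<lambda>x. r *\<^sub>R u x + s *\<^sub>R v x) w = r * B u w + s * B v w"
    and sym: "\<And>u v. u \<in> D \<Longrightarrow> v \<in> D \<Longrightarrow> B u v = B v u"
    and "a \<in> D" "b \<in> D" "c \<in> D"
  shows "2 * B (\<lambda>x. 3 *\<^sub>R a x - 4 *\<^sub>R b x + c x) a
    = B a a + B (\<lambda>x. 2 *\<^sub>R a x - b x) (\<lambda>x. 2 *\<^sub>R a x - b x)
    - B b b - B (\<lambda>x. 2 *\<^sub>R b x - c x) (\<lambda>x. 2 *\<^sub>R b x - c x)
    + B (\<lambda>x. a x - 2 *\<^sub>R b x + c x) (\<lambda>x. a x - 2 *\<^sub>R b x + c x)"
proof -
  \<comment> \<open>With combinations hidden behind a constant, bilinearity becomes a set of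
    first-order rewrite rules, and the identity reduces to expanding both sides.\<close>
  define lc where "lc r s u v = (\<lambda>x. r *\<^sub>R u x + s *\<^sub>R v x)" for r s and u v :: "'x \<Rightarrow> 'b"
  have lc: "lc r s u v \<in> D" if "u \<in> D" "v \<in> D" for u v r s
    unfolding lc_def using closed that .
  have lin: "B (lc r s u v) w = r * B u w + s * B v w" if "u \<in> D" "v \<in> D" "w \<in> D" for u v w r s
    unfolding lc_def using linear that .
  have lin': "B w (lc r s u v) = r * B w u + s * B w v" if "u \<in> D" "v \<in> D" "w \<in> D" for u v w r s
    using lin[OF that] sym that lc by metis
  have eqs: "(\<lambda>x. 3 *\<^sub>R a x - 4 *\<^sub>R b x + c x) = lc 1 1 (lc 3 (-4) a b) c"
    "(\<lambda>x. 2 *\<^sub>R a x - b x) = lc 2 (-1) a b" "(\<lambda>x. 2 *\<^sub>R b x - c x) = lc 2 (-1) b c"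
    "(\<lambda>x. a x - 2 *\<^sub>R b x + c x) = lc 1 1 (lc 1 (-2) a b) c"
    by (simp_all add: lc_def)
  show ?thesis
    unfolding eqs using assms(4-6) sym[of b a] sym[of c a] sym[of c b]
    by (simp add: lin lin' lc algebra_simps)
qed

text \<open>For positive \<open>a\<close> the polynomial is convex and not positive at 1, so it has
  real roots and 1 lies between them. If the smaller root is nonnegative, then \<xi> is that root.
  Otherwise \<xi> = 0, and 0 lies between the smaller root and 1, where the polynomial is not
  positive. For \<open>a = 0\<close> it is the constant \<open>c\<close>, so any \<xi> would
  do.\<close>

lemma smaller_root_relaxation:
  fixes a b c :: real
  assumes "0 \<le> a" "a + b + c \<le> 0" "a = 0 \<Longrightarrow> b = 0"
  defines "\<xi> \<equiv> max 0 ((- b - sqrt (b\<^sup>2 - 4 * a * c)) / (2 * a))"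
  shows "a * \<xi>\<^sup>2 + b * \<xi> + c \<le> 0"
proof (cases "a = 0")
  case True
  then show ?thesis using assms by simp
next
  case False
  with assms have "0 < a" by simp
  define s where "s = sqrt (b\<^sup>2 - 4 * a * c)"
  have "a * (a + b + c) \<le> 0"
    using \<open>0 < a\<close> assms(2) by (simp add: mult_nonneg_nonpos)
  \<comment> \<open>The right side minus the left side is -4 a (a + b + c). In particular the
    discriminant is nonnegative, so that \<open>s\<close> is a genuine square root.\<close>
  then have disc: "(b + 2 * a)\<^sup>2 \<le> b\<^sup>2 - 4 * a * c"
    by (simp add: power2_eq_square algebra_simps)
  then have s2: "s\<^sup>2 = b\<^sup>2 - 4 * a * c"
    unfolding s_def by (smt (verit) real_sqrt_pow2 zero_le_power2)
  have "\<bar>b + 2 * a\<bar> \<le> s"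
    unfolding s_def using disc by (simp add: real_le_rsqrt)
  show ?thesis
  proof (cases "0 \<le> - b - s")
    case True
    then have \<xi>: "\<xi> = (- b - s) / (2 * a)"
      using \<open>0 < a\<close> by (simp add: \<xi>_def s_def)
    have "4 * a * (a * \<xi>\<^sup>2 + b * \<xi> + c) = (2 * a * \<xi> + b)\<^sup>2 - s\<^sup>2"
      unfolding s2 by (simp add: power2_eq_square algebra_simps)
    also have "\<dots> = 0"
      using \<open>0 < a\<close> by (simp add: \<xi>)
    finally show ?thesis using \<open>0 < a\<close> by simp
  next
    case False
    then have "\<xi> = 0"
      using \<open>0 < a\<close> by (simp add: \<xi>_def s_def divide_nonpos_pos)
    moreover have "c \<le> 0"
    proof -
      \<comment> \<open>The case assumption gives -b < s, and b \<le> b + 2 a \<le> s. Hence b^2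
        \<le> b^2 - 4 a c, which forces c \<le> 0.\<close>
      have "\<bar>b\<bar> \<le> s"
        using False \<open>\<bar>b + 2 * a\<bar> \<le> s\<close> \<open>0 < a\<close> by linarith
      then have "b\<^sup>2 \<le> s\<^sup>2"
        using power_mono[of "\<bar>b\<bar>" s 2] by simp
      then show ?thesis using s2 \<open>0 < a\<close> by (simp add: mult_le_0_iff)
    qed
    ultimately show ?thesis by simp
  qed
qed

section \<open>The divergence\<close>

lemma divergence_eq_sum:
  assumes "(F has_derivative F') (at x)"
  shows "divergence F x = (\<Sum>j\<in>UNIV. F' (axis j 1) $ j)"
  using frechet_derivative_at[OF assms]
  by (simp add: divergence_def jacobian_def trace_def matrix_def)

text \<open>The product rule, entry by entry. Its left side is the integrand whose integral vanishes
  in \<open>eq_model\<close>, so integrating it yields integration by parts without boundary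
  terms.\<close>

lemma divergence_transpose_mult:
  fixes T :: "real^'d \<Rightarrow> real^'d^'m" and v :: "real^'d \<Rightarrow> real^'m"
  assumes "T differentiable (at x)" "v differentiable (at x)"
  shows "divergence (\<lambda>y. transpose (T y) *v v y) x
    = tensor_divergence T x \<bullet> v x + T x \<bullet> gradient_field v x"
proof -
  obtain T' v' where T: "(T has_derivative T') (at x)" and v: "(v has_derivative v') (at x)"
    using assms unfolding differentiable_def by auto
  have Ti: "((\<lambda>y. T y $ i) has_derivative (\<lambda>k. T' k $ i)) (at x)" for i
    by (rule bounded_linear.has_derivative[OF bounded_linear_vec_nth T])
  have Tij: "((\<lambda>y. T y $ i $ j) has_derivative (\<lambda>k. T' k $ i $ j)) (at x)" for i j
    by (rule bounded_linear.has_derivative[OF bounded_linear_vec_nth Ti])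
  have vi: "((\<lambda>y. v y $ i) has_derivative (\<lambda>k. v' k $ i)) (at x)" for i
    by (rule bounded_linear.has_derivative[OF bounded_linear_vec_nth v])
  \<comment> \<open>The derivative of component \<open>j\<close> of the field, which is the sum over
    \<open>i\<close> of \<open>T y $ i $ j * v y $ i\<close>.\<close>
  let ?F' = "\<lambda>k. \<chi> j. \<Sum>i\<in>UNIV. T x $ i $ j * v' k $ i + T' k $ i $ j * v x $ i"
  have "((\<lambda>y. \<Sum>i\<in>UNIV. T y $ i $ j * v y $ i) has_derivative (\<lambda>k. ?F' k $ j)) (at x)" for j
    unfolding vec_lambda_beta by (intro has_derivative_sum has_derivative_mult Tij vi)
  then have "((\<lambda>y. transpose (T y) *v v y) has_derivative ?F') (at x)"
    by (subst has_derivative_componentwise_within)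
       (auto simp: Basis_vec_def inner_axis matrix_vector_mult_def transpose_def)
  from divergence_eq_sum[OF this]
  have "divergence (\<lambda>y. transpose (T y) *v v y) x
    = (\<Sum>j\<in>UNIV. \<Sum>i\<in>UNIV. T' (axis j 1) $ i $ j * v x $ i)
    + (\<Sum>j\<in>UNIV. \<Sum>i\<in>UNIV. T x $ i $ j * v' (axis j 1) $ i)"
    by (simp add: sum.distrib)
  moreover have "tensor_divergence T x \<bullet> v x
    = (\<Sum>j\<in>UNIV. \<Sum>i\<in>UNIV. T' (axis j 1) $ i $ j * v x $ i)"
    using divergence_eq_sum[OF Ti]
    by (simp add: tensor_divergence_def inner_vec_def sum_distrib_right sum.swap[of _ "UNIV::'d set"])
  moreover have "T x \<bullet> gradient_field v x = (\<Sum>j\<in>UNIV. \<Sum>i\<in>UNIV. T x $ i $ j * v' (axis j 1) $ i)"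
    using frechet_derivative_at[OF v]
    by (simp add: jacobian_def matrix_def inner_vec_def sum.swap[of _ "UNIV::'d set"])
  ultimately show ?thesis by simp
qed

section \<open>Energy estimates\<close>

text \<open>The two-level energy on either side of the final inequality; the primed arguments belong
  to the later level. When both levels coincide it is the quadratized energy 1/2 (\<phi>, L0 \<phi>)
  + 1/2 |q|^2.\<close>

definition bdf2_energy ::
    "('d::finite, 'm::finite) eq_data \<Rightarrow> (real^'d \<Rightarrow> real^'m) \<Rightarrow> (real^'d \<Rightarrow> real) \<Rightarrow>
     (real^'d \<Rightarrow> real^'m) \<Rightarrow> (real^'d \<Rightarrow> real) \<Rightarrow> real" where
  "bdf2_energy M \<phi> q \<phi>' q' =
     1/4 * (L2_inner (Omega M) \<phi>' (L0 M \<phi>')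
            + L2_inner (Omega M) (\<lambda>x. 2 *\<^sub>R \<phi>' x - \<phi> x) (L0 M (\<lambda>x. 2 *\<^sub>R \<phi>' x - \<phi> x))
            + (L2_norm (Omega M) q')\<^sup>2
            + (L2_norm (Omega M) (\<lambda>x. 2 * q' x - q x))\<^sup>2)"

text \<open>Free of fractions, so that linear arithmetic applies to it directly.\<close>

lemma bdf2_energy_times_4:
  "4 * bdf2_energy M \<phi> q \<phi>' q' = L2_inner (Omega M) \<phi>' (L0 M \<phi>')
    + L2_inner (Omega M) (\<lambda>x. 2 *\<^sub>R \<phi>' x - \<phi> x) (L0 M (\<lambda>x. 2 *\<^sub>R \<phi>' x - \<phi> x))
    + L2_inner (Omega M) q' q' + L2_inner (Omega M) (\<lambda>x. 2 * q' x - q x) (\<lambda>x. 2 * q' x - q x)"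
  by (simp add: bdf2_energy_def L2_norm_power2)

lemma eq_modelD:
  assumes "eq_model M"
  shows "open (Omega M)" "bounded (Omega M)"
    "\<And>\<phi> x. \<phi> \<in> states M \<Longrightarrow> x \<in> Omega M \<Longrightarrow> \<phi> differentiable (at x)"
    "aux M \<subseteq> L2_functions (Omega M)"
    "linear_operator (Omega M) (states M) (L0 M)"
    "symmetric_on (Omega M) (states M) (L0 M)"
    "pos_semidef_on (Omega M) (states M) (L0 M)"
    "linear_operator (Omega M) (root_dom M) (rootL0 M)"
    "states M \<subseteq> root_dom M"
    "linear_operator (Omega M) (mob_dom M) (Ga M)"
    "skew_symmetric_on (Omega M) (mob_dom M) (Ga M)"
    "linear_operator (Omega M) (mob_dom M) (Gs M)"
    "pos_semidef_on (Omega M) (mob_dom M) (Gs M)"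
    "\<And>\<phi>. \<phi> \<in> states M \<Longrightarrow> integrable (lebesgue_on (Omega M)) (edens M \<phi>)"
    "\<And>\<phi>. \<phi> \<in> states M \<Longrightarrow> AE x in lebesgue_on (Omega M). 0 \<le> h_radicand M \<phi> x"
    "\<And>\<phi> p x. \<phi> \<in> states M \<Longrightarrow> p \<in> aux M \<Longrightarrow> x \<in> Omega M \<Longrightarrow> flux M \<phi> p differentiable (at x)"
    "\<And>\<phi> p v. \<phi> \<in> states M \<Longrightarrow> p \<in> aux M \<Longrightarrow> v \<in> states M \<Longrightarrow>
       has_bochner_integral (lebesgue_on (Omega M))
         (divergence (\<lambda>y. transpose (flux M \<phi> p y) *v v y)) 0"
  using assms unfolding eq_model_def by blast+

section \<open>Adjointness, dissipation and integrability of \<open>h\<close>\<close>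

text \<open>On \<open>Omega M\<close> the two integrands differ pointwise by the divergence of the
  transposed flux applied to \<open>v\<close>, which has integral 0 by \<open>eq_model\<close>.
  Integrability is a conclusion here because \<open>N0_adj M \<Psi> v\<close> contains a gradient
  that is not assumed to be in L2.\<close>

lemma
  assumes M: "eq_model M" and \<Psi>: "phi_part \<Psi> \<in> states M" and U: "q_part U \<in> aux M"
    and v: "v \<in> states M" and w: "N0_op M \<Psi> U \<in> L2_functions (Omega M)"
  shows integrable_inner_N0_adj:
      "integrable (lebesgue_on (Omega M)) (\<lambda>x. U x \<bullet> N0_adj M \<Psi> v x)"
    and L2_inner_N0_adj:
      "L2_inner (Omega M) U (N0_adj M \<Psi> v) = L2_inner (Omega M) (N0_op M \<Psi> U) v"
proof -
  let ?F = "flux M (phi_part \<Psi>) (q_part U)"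
  have "Omega M \<in> sets lebesgue"
    using eq_modelD(1)[OF M] by simp
  have v_L2: "v \<in> L2_functions (Omega M)"
    using linear_operatorD(2)[OF eq_modelD(5)[OF M] v] .
  have eq: "N0_op M \<Psi> U x \<bullet> v x + divergence (\<lambda>y. transpose (?F y) *v v y) x = U x \<bullet> N0_adj M \<Psi> v x"
    if "x \<in> Omega M" for x
  proof -
    from divergence_transpose_mult[OF eq_modelD(16)[OF M \<Psi> U that] eq_modelD(3)[OF M v that]] show ?thesis
      by (simp add: N0_op_def N0_adj_def flux_def[of _ _ _ x] inner_prod_def inner_add_left
          inner_diff_left algebra_simps)
  qed
  have "has_bochner_integral (lebesgue_on (Omega M)) (\<lambda>x. N0_op M \<Psi> U x \<bullet> v x)
          (L2_inner (Omega M) (N0_op M \<Psi> U) v)"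
    using integrable_inner_L2_functions[OF w v_L2]
    by (simp add: L2_inner_def has_bochner_integral_integrable)
  moreover have "has_bochner_integral (lebesgue_on (Omega M))
          (divergence (\<lambda>y. transpose (?F y) *v v y)) 0"
    by (rule eq_modelD(17)[OF M \<Psi> U v])
  ultimately have "has_bochner_integral (lebesgue_on (Omega M))
      (\<lambda>x. N0_op M \<Psi> U x \<bullet> v x + divergence (\<lambda>y. transpose (?F y) *v v y) x)
      (L2_inner (Omega M) (N0_op M \<Psi> U) v + 0)"
    by (rule has_bochner_integral_add)
  then have "has_bochner_integral (lebesgue_on (Omega M)) (\<lambda>x. U x \<bullet> N0_adj M \<Psi> v x)
      (L2_inner (Omega M) (N0_op M \<Psi> U) v)"
    by (subst (asm) has_bochner_integral_cong[OF refl eq]) (use \<open>Omega M \<in> sets lebesgue\<close> in auto)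
  then show "integrable (lebesgue_on (Omega M)) (\<lambda>x. U x \<bullet> N0_adj M \<Psi> v x)"
    "L2_inner (Omega M) U (N0_adj M \<Psi> v) = L2_inner (Omega M) (N0_op M \<Psi> U) v"
    by (simp_all add: has_bochner_integral_iff L2_inner_def)
qed

text \<open>Skew-symmetry gives (Ga w, w) = -(w, Ga w), so this term is its own negative and
  vanishes; only the positive semi-definite part remains.\<close>

lemma mobility_dissipative:
  assumes M: "eq_model M" and w: "w \<in> mob_dom M"
  shows "0 \<le> L2_inner (Omega M) w (mobility M w)"
proof -
  have L2: "w \<in> L2_functions (Omega M)" "Ga M w \<in> L2_functions (Omega M)" "Gs M w \<in> L2_functions (Omega M)"
    using linear_operatorD[OF eq_modelD(10)[OF M]] linear_operatorD[OF eq_modelD(12)[OF M]] w by auto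
  have "L2_inner (Omega M) (mobility M w) w
      = L2_inner (Omega M) (Ga M w) w + L2_inner (Omega M) (Gs M w) w"
    using L2_inner_lincomb_left[OF L2(2,3,1), of 1 1] by (simp add: mobility_def[abs_def])
  moreover have "L2_inner (Omega M) (Ga M w) w = - L2_inner (Omega M) w (Ga M w)"
    using eq_modelD(11)[OF M] w unfolding skew_symmetric_on_def by blast
  moreover have "0 \<le> L2_inner (Omega M) (Gs M w) w"
    using eq_modelD(13)[OF M] w unfolding pos_semidef_on_def by blast
  ultimately show ?thesis
    using L2_inner_commute[of "Omega M" w "Ga M w"] L2_inner_commute[of "Omega M" w "mobility M w"]
    by linarith
qed

text \<open>The square of \<open>h\<close> is almost everywhere the radicand. That is integrable,
  being built from the integrable energy density, the square of the L2 function
  \<open>rootL0 M \<phi>\<close>, and a constant on a bounded domain.\<close>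

lemma h_in_L2_functions:
  assumes M: "eq_model M" and \<phi>: "\<phi> \<in> states M"
  shows "h M \<phi> \<in> L2_functions (Omega M)"
proof -
  have "Omega M \<in> lmeasurable"
    using eq_modelD(1,2)[OF M] by (simp add: lmeasurable_open)
  then have "integrable (lebesgue_on (Omega M)) (\<lambda>x. c)" for c :: real
    by (simp add: finite_measure.integrable_const finite_measure_lebesgue_on)
  moreover have "rootL0 M \<phi> \<in> L2_functions (Omega M)"
    using linear_operatorD(3)[OF eq_modelD(8)[OF M]] eq_modelD(9)[OF M] \<phi> by blast
  then have "integrable (lebesgue_on (Omega M)) (\<lambda>x. (norm (rootL0 M \<phi> x))\<^sup>2)"
    by (simp add: L2_functions_def power2_norm_eq_inner)
  moreover note eq_modelD(14)[OF M \<phi>]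
  ultimately have rad: "integrable (lebesgue_on (Omega M)) (h_radicand M \<phi>)"
    unfolding h_radicand_def[abs_def] by simp
  then have h: "h M \<phi> \<in> borel_measurable (lebesgue_on (Omega M))"
    unfolding h_def[abs_def] by (auto intro: borel_measurable_sqrt)
  from eq_modelD(15)[OF M \<phi>] have "AE x in lebesgue_on (Omega M). h_radicand M \<phi> x = h M \<phi> x \<bullet> h M \<phi> x"
    by eventually_elim (simp add: h_def)
  then have "integrable (lebesgue_on (Omega M)) (\<lambda>x. h M \<phi> x \<bullet> h M \<phi> x)"
    using h by (intro integrable_cong_AE_imp[OF rad]) auto
  with h show ?thesis
    by (simp add: L2_functions_def)
qed

section \<open>Energy drop in the first step\<close>

lemma
  assumes M: "eq_model M" and "0 < \<delta>t"
    and \<phi>: "phi_part \<Psi>\<^sub>0 \<in> states M" "phi_part \<Psi>\<^sub>1 \<in> states M"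
    and q: "q_part \<Psi>\<^sub>0 \<in> L2_functions (Omega M)" "q_part \<Psi>\<^sub>1 \<in> L2_functions (Omega M)"
    and step: "bdf2_step1 M \<delta>t \<Psi>\<^sub>0 \<Psi>\<^sub>1 \<Psi>h"
  defines "D \<equiv> L2_inner (Omega M) (L_op M \<Psi>h) (N_op M (extrapolate \<Psi>\<^sub>0 \<Psi>\<^sub>1) (L_op M \<Psi>h))"
  shows bdf2_dissipation_nonneg: "0 \<le> D"
    and bdf2_step1_energy: "bdf2_energy M (phi_part \<Psi>\<^sub>1) (q_part \<Psi>\<^sub>1) (phi_part \<Psi>h) (q_part \<Psi>h)
      \<le> bdf2_energy M (phi_part \<Psi>\<^sub>0) (q_part \<Psi>\<^sub>0) (phi_part \<Psi>\<^sub>1) (q_part \<Psi>\<^sub>1) - \<delta>t * D"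
proof -
  define \<phi>h qh \<phi>0 \<phi>1 q0 q1 \<Omega> where d:
    "\<phi>h = phi_part \<Psi>h" "qh = q_part \<Psi>h" "\<phi>0 = phi_part \<Psi>\<^sub>0" "\<phi>1 = phi_part \<Psi>\<^sub>1"
    "q0 = q_part \<Psi>\<^sub>0" "q1 = q_part \<Psi>\<^sub>1" "\<Omega> = Omega M"
  define w where "w = N0_op M (extrapolate \<Psi>\<^sub>0 \<Psi>\<^sub>1) (L_op M \<Psi>h)"
  have subsp: "L2_subspace \<Omega> (states M)"
    and states_L2: "u \<in> states M \<Longrightarrow> u \<in> L2_functions \<Omega>"
    and L0_L2: "u \<in> states M \<Longrightarrow> L0 M u \<in> L2_functions \<Omega>" for u
    using linear_operatorD[OF eq_modelD(5)[OF M]] by (simp_all add: d)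
  have \<phi>h: "\<phi>h \<in> states M" and "qh \<in> aux M" and w: "w \<in> mob_dom M"
    and v: "mobility M w \<in> states M"
    using step unfolding bdf2_step1_def d w_def by auto
  have qh: "qh \<in> L2_functions \<Omega>"
    using eq_modelD(4)[OF M] \<open>qh \<in> aux M\<close> by (auto simp: d)
  have w_L2: "w \<in> L2_functions \<Omega>"
    using linear_operatorD(2)[OF eq_modelD(10)[OF M] w] by (simp add: d)
  have ex: "phi_part (extrapolate \<Psi>\<^sub>0 \<Psi>\<^sub>1) \<in> states M"
    using L2_subspace_lincomb[OF subsp \<phi>(2,1), of 2 "-1"] by (simp add: extrapolate_def)
  have aux: "q_part (L_op M \<Psi>h) \<in> aux M"
    using \<open>qh \<in> aux M\<close> by (simp add: L_op_def d)
  note adj = M ex aux v w_L2[unfolded w_def d]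
  have "D = L2_inner \<Omega> w (mobility M w)"
    unfolding D_def N_op_def w_def[symmetric] using L2_inner_N0_adj[OF adj] by (simp add: d w_def)
  then show "0 \<le> D"
    using mobility_dissipative[OF M w] by (simp add: d)

  \<comment> \<open>\<open>r\<close> and \<open>s\<close> are the two components of the BDF2
    difference, without the factor 1 / (2 \<delta>t).\<close>
  define r where "r = (\<lambda>x. 3 *\<^sub>R \<phi>h x - 4 *\<^sub>R \<phi>1 x + \<phi>0 x)"
  define s where "s = (\<lambda>x. 3 *\<^sub>R qh x - 4 *\<^sub>R q1 x + q0 x)"
  have bdf_comb: "(\<lambda>x. 3 *\<^sub>R a x - 4 *\<^sub>R b x + c x) \<in> S"
    if "L2_subspace \<Omega> S" "a \<in> S" "b \<in> S" "c \<in> S"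
    for S and a b c :: "real^'a \<Rightarrow> 'z::euclidean_space"
    using L2_subspace_lincomb[OF that(1) L2_subspace_lincomb[OF that(1-3), of 3 "-4"] that(4), of 1 1]
    by simp
  have r: "r \<in> L2_functions \<Omega>"
    unfolding r_def by (rule states_L2, rule bdf_comb[OF subsp]) (use \<phi> \<phi>h d in auto)
  have s: "s \<in> L2_functions \<Omega>"
    unfolding s_def by (rule bdf_comb[OF L2_subspace_L2_functions]) (use q qh d in auto)
  have "AE x in lebesgue_on \<Omega>. L_op M \<Psi>h x \<bullet> N_op M (extrapolate \<Psi>\<^sub>0 \<Psi>\<^sub>1) (L_op M \<Psi>h) x
      = - (1 / (2 * \<delta>t)) * (r x \<bullet> L0 M \<phi>h x + s x \<bullet> qh x)"
  proof -
    have "AE x in lebesgue_on \<Omega>. (1 / (2 * \<delta>t)) *\<^sub>R (3 *\<^sub>R \<Psi>h x - 4 *\<^sub>R \<Psi>\<^sub>1 x + \<Psi>\<^sub>0 x)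
        = - N_op M (extrapolate \<Psi>\<^sub>0 \<Psi>\<^sub>1) (L_op M \<Psi>h) x"
      using step unfolding bdf2_step1_def d by blast
    then show ?thesis
    proof eventually_elim
      case (elim x)
      have "3 *\<^sub>R \<Psi>h x - 4 *\<^sub>R \<Psi>\<^sub>1 x + \<Psi>\<^sub>0 x = (r x, s x)"
        by (simp add: r_def s_def d prod_eq_iff)
      with elim have "- N_op M (extrapolate \<Psi>\<^sub>0 \<Psi>\<^sub>1) (L_op M \<Psi>h) x = (1 / (2 * \<delta>t)) *\<^sub>R (r x, s x)"
        by simp
      then have "N_op M (extrapolate \<Psi>\<^sub>0 \<Psi>\<^sub>1) (L_op M \<Psi>h) x = - ((1 / (2 * \<delta>t)) *\<^sub>R (r x, s x))"
        by (rule minus_equation_iff[THEN iffD1, symmetric])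
      then show ?case
        by (simp add: L_op_def d inner_prod_def inner_commute algebra_simps)
    qed
  qed
  \<comment> \<open>Supplies the measurability that \<open>integral_cong_AE\<close> asks for. It
    comes from the adjoint relation, as \<open>N_op\<close> is not known to map into L2.\<close>
  moreover have "integrable (lebesgue_on \<Omega>)
      (\<lambda>x. L_op M \<Psi>h x \<bullet> N_op M (extrapolate \<Psi>\<^sub>0 \<Psi>\<^sub>1) (L_op M \<Psi>h) x)"
    unfolding N_op_def w_def[symmetric] using integrable_inner_N0_adj[OF adj] by (simp add: d w_def)
  moreover have int: "integrable (lebesgue_on \<Omega>) (\<lambda>x. r x \<bullet> L0 M \<phi>h x)"
      "integrable (lebesgue_on \<Omega>) (\<lambda>x. s x \<bullet> qh x)"
    by (rule integrable_inner_L2_functions[OF r L0_L2[OF \<phi>h]], rule integrable_inner_L2_functions[OF s qh])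
  ultimately have "D = (LINT x|lebesgue_on \<Omega>. - (1 / (2 * \<delta>t)) * (r x \<bullet> L0 M \<phi>h x + s x \<bullet> qh x))"
    unfolding D_def L2_inner_def d(7)[symmetric]
    by (intro integral_cong_AE borel_measurable_integrable) auto
  also have "\<dots> = - (1 / (2 * \<delta>t)) * (L2_inner \<Omega> r (L0 M \<phi>h) + L2_inner \<Omega> s qh)"
    using int by (simp add: L2_inner_def)
  \<comment> \<open>Scaled so that the left side matches \<open>bdf2_identity\<close> and the right
    side matches four times the energy.\<close>
  finally have D: "2 * L2_inner \<Omega> r (L0 M \<phi>h) + 2 * L2_inner \<Omega> s qh = - 4 * (\<delta>t * D)"
    using \<open>0 < \<delta>t\<close> by (simp add: field_simps)

  have L0_pos: "0 \<le> L2_inner \<Omega> u (L0 M u)" if "u \<in> states M" for u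
    using eq_modelD(7)[OF M] that unfolding pos_semidef_on_def d(7) L2_inner_commute[of _ u] by blast
  have L0_sym: "L2_inner \<Omega> u (L0 M v) = L2_inner \<Omega> v (L0 M u)"
    if "u \<in> states M" "v \<in> states M" for u v
    using eq_modelD(6)[OF M] that unfolding symmetric_on_def d(7) L2_inner_commute[of _ v] by simp
  \<comment> \<open>The second difference of \<phi>: its \<open>L0\<close> energy, like the squared
    norm of the second difference of \<open>q\<close> below, is nonnegative and is discarded, which
    turns the energy identity into an inequality.\<close>
  have "(\<lambda>x. \<phi>h x - 2 *\<^sub>R \<phi>1 x + \<phi>0 x) \<in> states M"
    using L2_subspace_lincomb[OF subsp L2_subspace_lincomb[OF subsp, of \<phi>h \<phi>1 1 "-2"], of \<phi>0 1 1]
      \<phi> \<phi>h by (simp add: d)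
  then have "0 \<le> L2_inner \<Omega> (\<lambda>x. \<phi>h x - 2 *\<^sub>R \<phi>1 x + \<phi>0 x) (L0 M (\<lambda>x. \<phi>h x - 2 *\<^sub>R \<phi>1 x + \<phi>0 x))"
    by (rule L0_pos)
  moreover have "2 * L2_inner \<Omega> r (L0 M \<phi>h)
    = L2_inner \<Omega> \<phi>h (L0 M \<phi>h) + L2_inner \<Omega> (\<lambda>x. 2 *\<^sub>R \<phi>h x - \<phi>1 x) (L0 M (\<lambda>x. 2 *\<^sub>R \<phi>h x - \<phi>1 x))
    - L2_inner \<Omega> \<phi>1 (L0 M \<phi>1) - L2_inner \<Omega> (\<lambda>x. 2 *\<^sub>R \<phi>1 x - \<phi>0 x) (L0 M (\<lambda>x. 2 *\<^sub>R \<phi>1 x - \<phi>0 x))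
    + L2_inner \<Omega> (\<lambda>x. \<phi>h x - 2 *\<^sub>R \<phi>1 x + \<phi>0 x) (L0 M (\<lambda>x. \<phi>h x - 2 *\<^sub>R \<phi>1 x + \<phi>0 x))"
    unfolding r_def
  proof (rule bdf2_identity[where D="states M" and B="\<lambda>u v. L2_inner \<Omega> u (L0 M v)"])
    show "L2_inner \<Omega> (\<lambda>x. t *\<^sub>R u x + t' *\<^sub>R v x) (L0 M z)
        = t * L2_inner \<Omega> u (L0 M z) + t' * L2_inner \<Omega> v (L0 M z)"
      if "u \<in> states M" "v \<in> states M" "z \<in> states M" for u v z t t'
      by (rule L2_inner_lincomb_left[OF states_L2[OF that(1)] states_L2[OF that(2)] L0_L2[OF that(3)]])
  qed (use \<phi> \<phi>h in \<open>auto simp: d(3,4) intro: L2_subspace_lincomb[OF subsp] L0_sym\<close>)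
  moreover have "2 * L2_inner \<Omega> s qh
    = L2_inner \<Omega> qh qh + L2_inner \<Omega> (\<lambda>x. 2 *\<^sub>R qh x - q1 x) (\<lambda>x. 2 *\<^sub>R qh x - q1 x)
    - L2_inner \<Omega> q1 q1 - L2_inner \<Omega> (\<lambda>x. 2 *\<^sub>R q1 x - q0 x) (\<lambda>x. 2 *\<^sub>R q1 x - q0 x)
    + L2_inner \<Omega> (\<lambda>x. qh x - 2 *\<^sub>R q1 x + q0 x) (\<lambda>x. qh x - 2 *\<^sub>R q1 x + q0 x)"
    unfolding s_def
    by (rule bdf2_identity[where D="L2_functions \<Omega>" and B="L2_inner \<Omega>",
          OF L2_subspace_lincomb[OF L2_subspace_L2_functions] L2_inner_lincomb_left L2_inner_commute])
       (use q qh in \<open>simp_all add: d(5-7)\<close>)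
  moreover have "0 \<le> L2_inner \<Omega> (\<lambda>x. qh x - 2 *\<^sub>R q1 x + q0 x) (\<lambda>x. qh x - 2 *\<^sub>R q1 x + q0 x)"
    by (rule L2_inner_nonneg)
  ultimately have "4 * bdf2_energy M \<phi>1 q1 \<phi>h qh \<le> 4 * bdf2_energy M \<phi>0 q0 \<phi>1 q1 - 4 * (\<delta>t * D)"
    using D unfolding bdf2_energy_times_4 d(7)[symmetric] real_scaleR_def by linarith
  then show "bdf2_energy M (phi_part \<Psi>\<^sub>1) (q_part \<Psi>\<^sub>1) (phi_part \<Psi>h) (q_part \<Psi>h)
      \<le> bdf2_energy M (phi_part \<Psi>\<^sub>0) (q_part \<Psi>\<^sub>0) (phi_part \<Psi>\<^sub>1) (q_part \<Psi>\<^sub>1) - \<delta>t * D"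
    unfolding d by simp
qed

section \<open>Energy change in the relaxation step\<close>

text \<open>With e = 2 k - q, the relaxed function is k + \<xi> d, and twice it minus
  \<open>q\<close> is e + 2 \<xi> d. Expanding both squares gives the leading coefficient 1 + 2^2 =
  5. The first two coefficients are four times the \<open>relax_a\<close> and \<open>relax_b\<close>
  of the scheme.\<close>

lemma L2_quadratic_relaxation:
  fixes \<Omega> :: "(real^'d) set" and k p q :: "real^'d \<Rightarrow> real"
  assumes "k \<in> L2_functions \<Omega>" "p \<in> L2_functions \<Omega>" "q \<in> L2_functions \<Omega>"
  defines "d \<equiv> \<lambda>x. p x - k x" and "y \<equiv> \<lambda>\<xi> x. \<xi> * p x + (1 - \<xi>) * k x"
  shows "L2_inner \<Omega> (y \<xi>) (y \<xi>) + L2_inner \<Omega> (\<lambda>x. 2 * y \<xi> x - q x) (\<lambda>x. 2 * y \<xi> x - q x)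
    = 5 * L2_inner \<Omega> d d * \<xi>\<^sup>2
    + 4 * (1/2 * L2_inner \<Omega> d k + L2_inner \<Omega> d (\<lambda>x. 2 * k x - q x)) * \<xi>
    + (L2_inner \<Omega> k k + L2_inner \<Omega> (\<lambda>x. 2 * k x - q x) (\<lambda>x. 2 * k x - q x))"
proof -
  let ?e = "\<lambda>x. 2 * k x - q x"
  note lincomb = L2_subspace_lincomb[OF L2_subspace_L2_functions]
  have d: "d \<in> L2_functions \<Omega>"
    using lincomb[OF assms(2,1), of 1 "-1"] by (simp add: d_def)
  have e: "?e \<in> L2_functions \<Omega>"
    using lincomb[OF assms(1,3), of 2 "-1"] by simp
  have square: "L2_inner \<Omega> (\<lambda>x. u x + t * d x) (\<lambda>x. u x + t * d x)
      = L2_inner \<Omega> u u + 2 * t * L2_inner \<Omega> d u + t\<^sup>2 * L2_inner \<Omega> d d"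
    if u: "u \<in> L2_functions \<Omega>" for u t
  proof -
    have ut: "(\<lambda>x. u x + t * d x) \<in> L2_functions \<Omega>"
      using lincomb[OF u d, of 1 t] by simp
    have lin: "L2_inner \<Omega> (\<lambda>x. u x + t * d x) z = L2_inner \<Omega> u z + t * L2_inner \<Omega> d z"
      if "z \<in> L2_functions \<Omega>" for z
      using L2_inner_lincomb_left[OF u d that, of 1 t] by simp
    show ?thesis
      unfolding lin[OF ut] L2_inner_commute[of \<Omega> u "\<lambda>x. u x + t * d x"]
        L2_inner_commute[of \<Omega> d "\<lambda>x. u x + t * d x"] lin[OF u] lin[OF d] L2_inner_commute[of \<Omega> u d]
      by algebra
  qed
  have y: "y \<xi> = (\<lambda>x. k x + \<xi> * d x)"
    by (simp add: y_def d_def algebra_simps)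
  have y2: "(\<lambda>x. 2 * (k x + \<xi> * d x) - q x) = (\<lambda>x. ?e x + (2 * \<xi>) * d x)"
    by (simp add: algebra_simps)
  show ?thesis
    unfolding y y2 square[OF assms(1)] square[OF e] by algebra
qed

text \<open>The integrand vanishes almost everywhere, whatever \<open>u\<close> is. In the scheme
  this makes \<open>relax_b\<close> vanish together with \<open>relax_a\<close>.\<close>

lemma L2_inner_eq_0_if_norm_0:
  fixes d u :: "real^'d \<Rightarrow> 'b::euclidean_space"
  assumes "d \<in> L2_functions \<Omega>" "L2_inner \<Omega> d d = 0"
  shows "L2_inner \<Omega> d u = 0"
proof -
  have "AE x in lebesgue_on \<Omega>. d x \<bullet> d x = 0"
    using assms integral_nonneg_eq_0_iff_AE[of "lebesgue_on \<Omega>" "\<lambda>x. d x \<bullet> d x"]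
    by (simp add: L2_inner_def L2_functions_def)
  then have "AE x in lebesgue_on \<Omega>. d x \<bullet> u x = 0"
    by eventually_elim simp
  then show ?thesis
    unfolding L2_inner_def by (rule integral_eq_zero_AE)
qed

text \<open>Allows the new auxiliary variable to be replaced by the formula of the relaxation step,
  to which it is equal only almost everywhere.\<close>

lemma bdf2_energy_cong_AE:
  assumes "AE x in lebesgue_on (Omega M). p x = p' x" "Omega M \<in> sets lebesgue"
    and "p' \<in> L2_functions (Omega M)" "q \<in> L2_functions (Omega M)"
  shows "bdf2_energy M \<phi> q \<phi>' p = bdf2_energy M \<phi> q \<phi>' p'"
proof -
  have "AE x in lebesgue_on (Omega M). p' x = p x"
    using assms(1) by eventually_elim simp
  then have p: "p \<in> L2_functions (Omega M)"
    by (rule L2_functions_cong_AE[OF assms(2,3)])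
  have L2: "(\<lambda>x. 2 * u x - q x) \<in> L2_functions (Omega M)" if "u \<in> L2_functions (Omega M)" for u
    using L2_subspace_lincomb[OF L2_subspace_L2_functions that assms(4), of 2 "-1"] by simp
  have "AE x in lebesgue_on (Omega M). 2 * p x - q x = 2 * p' x - q x"
    using assms(1) by eventually_elim simp
  note eq = this
  have "L2_inner (Omega M) (\<lambda>x. 2 * p x - q x) (\<lambda>x. 2 * p x - q x)
      = L2_inner (Omega M) (\<lambda>x. 2 * p' x - q x) (\<lambda>x. 2 * p' x - q x)"
    by (rule L2_inner_cong_AE[OF L2[OF p] L2[OF assms(3)] L2[OF p] L2[OF assms(3)] eq eq])
  moreover have "L2_inner (Omega M) p p = L2_inner (Omega M) p' p'"
    by (rule L2_inner_cong_AE[OF p assms(3) p assms(3) assms(1) assms(1)])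
  ultimately show ?thesis
    by (simp add: bdf2_energy_def L2_norm_power2)
qed

text \<open>The dynamics enter only through the sign of the dissipation term; the rest is a
  statement about three L2 functions and a quadratic polynomial.\<close>

lemma bdf2_relaxation_energy:
  fixes M :: "('d::finite, 'm::finite) eq_data" and \<delta>t \<eta> :: real
    and \<Psi>\<^sub>0 \<Psi>\<^sub>1 \<Psi>h :: "real^'d \<Rightarrow> (real^'m) \<times> real"
  assumes "qh \<in> L2_functions (Omega M)" "h M \<phi> \<in> L2_functions (Omega M)"
    and "q_part \<Psi>\<^sub>1 \<in> L2_functions (Omega M)"
    and \<Psi>h: "\<Psi>h = pair_fun \<phi> qh"
  defines "\<xi> \<equiv> relax_xi M \<delta>t \<eta> \<Psi>\<^sub>0 \<Psi>\<^sub>1 \<Psi>h"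
    and "D \<equiv> L2_inner (Omega M) (L_op M \<Psi>h) (N_op M (extrapolate \<Psi>\<^sub>0 \<Psi>\<^sub>1) (L_op M \<Psi>h))"
  assumes "0 \<le> \<delta>t * \<eta> * D"
  shows "bdf2_energy M \<phi>1 (q_part \<Psi>\<^sub>1) \<phi> (\<lambda>x. \<xi> * qh x + (1 - \<xi>) * h M \<phi> x)
    \<le> bdf2_energy M \<phi>1 (q_part \<Psi>\<^sub>1) \<phi> qh + \<delta>t * \<eta> * D"
proof -
  let ?k = "h M \<phi>" and ?q = "q_part \<Psi>\<^sub>1"
  let ?d = "\<lambda>x. qh x - ?k x" and ?e = "\<lambda>x. 2 * ?k x - ?q x"
    and ?y = "\<lambda>t x. t * qh x + (1 - t) * ?k x"
  define a where "a = relax_a M \<Psi>h"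
  define b where "b = relax_b M \<Psi>\<^sub>1 \<Psi>h"
  define c where "c = relax_c M \<delta>t \<eta> \<Psi>\<^sub>0 \<Psi>\<^sub>1 \<Psi>h"
  have a: "4 * a = 5 * L2_inner (Omega M) ?d ?d"
    by (simp add: a_def relax_a_def \<Psi>h L2_norm_power2)
  have b: "b = 1/2 * L2_inner (Omega M) ?d ?k + L2_inner (Omega M) ?d ?e"
    by (simp add: b_def relax_b_def Let_def \<Psi>h)
  \<comment> \<open>Adding \<delta>t \<eta> D cancels the dissipation term inside
    \<open>relax_c\<close> and leaves only inner products of auxiliary variables.\<close>
  have c: "4 * (c + \<delta>t * \<eta> * D) = L2_inner (Omega M) ?k ?k + L2_inner (Omega M) ?e ?e
      - L2_inner (Omega M) qh qh - L2_inner (Omega M) (\<lambda>x. 2 * qh x - ?q x) (\<lambda>x. 2 * qh x - ?q x)"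
    by (simp add: c_def relax_c_def D_def Let_def \<Psi>h L2_norm_power2)
  have E: "bdf2_energy M \<phi>1 ?q \<phi> (?y t) = bdf2_energy M \<phi>1 ?q \<phi> qh + \<delta>t * \<eta> * D + (a * t\<^sup>2 + b * t + c)"
    for t
  proof -
    have "L2_inner (Omega M) (?y t) (?y t)
        + L2_inner (Omega M) (\<lambda>x. 2 * ?y t x - ?q x) (\<lambda>x. 2 * ?y t x - ?q x)
      = (4 * a) * t\<^sup>2 + 4 * b * t + 4 * (c + \<delta>t * \<eta> * D) + L2_inner (Omega M) qh qh
        + L2_inner (Omega M) (\<lambda>x. 2 * qh x - ?q x) (\<lambda>x. 2 * qh x - ?q x)"
      unfolding L2_quadratic_relaxation[OF assms(2,1,3)] a b c by simp
    then have "4 * bdf2_energy M \<phi>1 ?q \<phi> (?y t)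
        = 4 * bdf2_energy M \<phi>1 ?q \<phi> qh + (4 * a) * t\<^sup>2 + 4 * b * t + 4 * (c + \<delta>t * \<eta> * D)"
      unfolding bdf2_energy_times_4 by linarith
    then show ?thesis
      by (simp add: algebra_simps)
  qed
  have "(\<lambda>x. qh x - h M \<phi> x) \<in> L2_functions (Omega M)"
    using L2_subspace_lincomb[OF L2_subspace_L2_functions assms(1,2), of 1 "-1"] by simp
  \<comment> \<open>The degenerate case, where \<open>relax_xi\<close> involves a division by zero:
    the polynomial is then constant in \<xi>.\<close>
  then have "b = 0" if "a = 0"
    using that a by (simp add: b L2_inner_eq_0_if_norm_0)
  \<comment> \<open>At \<open>t = 1\<close> the relaxed function is \<open>qh\<close> itself, so
    \<open>E\<close> gives a + b + c = -\<delta>t \<eta> D.\<close>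
  moreover have "a + b + c \<le> 0"
    using E[of 1] assms(7) by simp
  moreover have "0 \<le> a"
    using a L2_inner_nonneg[of "Omega M" ?d] by simp
  ultimately have "a * \<xi>\<^sup>2 + b * \<xi> + c \<le> 0"
    unfolding \<xi>_def relax_xi_def Let_def a_def[symmetric] b_def[symmetric] c_def[symmetric]
    using smaller_root_relaxation by blast
  then show ?thesis using E[of \<xi>] by simp
qed

section \<open>Combination of the two steps\<close>

theorem theorem3p2:
  fixes M :: "('d::finite, 'm::finite) eq_data"
    and \<phi> :: "nat \<Rightarrow> real^'d \<Rightarrow> real^'m"
    and q :: "nat \<Rightarrow> real^'d \<Rightarrow> real"
    and \<delta>t \<eta> :: real
    and n :: nat
  assumes "eq_model M"
    and "\<delta>t > 0"
    and "0 \<le> \<eta>" and "\<eta> \<le> 1"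
    and "n \<ge> 1"
    and "relaxed_bdf2 M \<delta>t \<eta> (pair_fun (\<phi> (n - 1)) (q (n - 1)))
           (pair_fun (\<phi> n) (q n)) (pair_fun (\<phi> (n + 1)) (q (n + 1)))"
  shows
    "1/4 * (L2_inner (Omega M) (\<phi> (n + 1)) (L0 M (\<phi> (n + 1)))
            + L2_inner (Omega M) (\<lambda>x. 2 *\<^sub>R \<phi> (n + 1) x - \<phi> n x)
                (L0 M (\<lambda>x. 2 *\<^sub>R \<phi> (n + 1) x - \<phi> n x))
            + (L2_norm (Omega M) (q (n + 1)))\<^sup>2
            + (L2_norm (Omega M) (\<lambda>x. 2 * q (n + 1) x - q n x))\<^sup>2)
     \<le> 1/4 * (L2_inner (Omega M) (\<phi> n) (L0 M (\<phi> n))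
            + L2_inner (Omega M) (\<lambda>x. 2 *\<^sub>R \<phi> n x - \<phi> (n - 1) x)
                (L0 M (\<lambda>x. 2 *\<^sub>R \<phi> n x - \<phi> (n - 1) x))
            + (L2_norm (Omega M) (q n))\<^sup>2
            + (L2_norm (Omega M) (\<lambda>x. 2 * q n x - q (n - 1) x))\<^sup>2)"
proof -
  let ?P = "\<lambda>k. pair_fun (\<phi> k) (q k)"
  \<comment> \<open>A function of \<open>qh\<close>, because the intermediate auxiliary variable is
    obtained from the scheme only afterwards.\<close>
  define D where "D qh = (let \<Psi>h = pair_fun (\<phi> (n + 1)) qh in L2_inner (Omega M) (L_op M \<Psi>h)
    (N_op M (extrapolate (?P (n - 1)) (?P n)) (L_op M \<Psi>h)))" for qh
  note M = assms(1)
  have \<Omega>: "Omega M \<in> sets lebesgue"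
    using eq_modelD(1)[OF M] by simp
  have \<phi>: "\<phi> (n - 1) \<in> states M" "\<phi> n \<in> states M"
    and q: "q (n - 1) \<in> L2_functions (Omega M)" "q n \<in> L2_functions (Omega M)"
    using assms(6) unfolding relaxed_bdf2_def by auto
  obtain qh \<xi> where \<xi>: "\<xi> = relax_xi M \<delta>t \<eta> (?P (n - 1)) (?P n) (pair_fun (\<phi> (n + 1)) qh)"
    and step: "bdf2_step1 M \<delta>t (?P (n - 1)) (?P n) (pair_fun (\<phi> (n + 1)) qh)"
    and q2: "AE x in lebesgue_on (Omega M). q (n + 1) x = \<xi> * qh x + (1 - \<xi>) * h M (\<phi> (n + 1)) x"
    using assms(6) unfolding relaxed_bdf2_def Let_def by auto
  have \<phi>2: "\<phi> (n + 1) \<in> states M" and "qh \<in> aux M"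
    using step unfolding bdf2_step1_def by auto
  then have qh: "qh \<in> L2_functions (Omega M)"
    using eq_modelD(4)[OF M] by auto
  note h = h_in_L2_functions[OF M \<phi>2]
  have D: "0 \<le> D qh" and energy:
    "bdf2_energy M (\<phi> n) (q n) (\<phi> (n + 1)) qh
      \<le> bdf2_energy M (\<phi> (n - 1)) (q (n - 1)) (\<phi> n) (q n) - \<delta>t * D qh"
    using bdf2_dissipation_nonneg[OF M assms(2) _ _ _ _ step]
      bdf2_step1_energy[OF M assms(2) _ _ _ _ step] \<phi> q
    by (simp_all add: D_def Let_def)
  have "bdf2_energy M (\<phi> n) (q n) (\<phi> (n + 1)) (q (n + 1))
      = bdf2_energy M (\<phi> n) (q n) (\<phi> (n + 1)) (\<lambda>x. \<xi> * qh x + (1 - \<xi>) * h M (\<phi> (n + 1)) x)"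
    using L2_subspace_lincomb[OF L2_subspace_L2_functions qh h, of \<xi> "1 - \<xi>"]
    by (intro bdf2_energy_cong_AE q2 \<Omega> q) simp
  also have "\<dots> \<le> bdf2_energy M (\<phi> n) (q n) (\<phi> (n + 1)) qh + \<delta>t * \<eta> * D qh"
    using bdf2_relaxation_energy[OF qh h, of "?P n" _ \<delta>t \<eta> "?P (n - 1)" "\<phi> n"]
      q D assms(2,3) by (simp add: \<xi> D_def Let_def)
  \<comment> \<open>The drop \<delta>t D of the first step absorbs the possible gain \<delta>t
    \<eta> D of the relaxation; the remainder has the right sign because \<eta> \<le> 1.\<close>
  also have "\<dots> \<le> bdf2_energy M (\<phi> (n - 1)) (q (n - 1)) (\<phi> n) (q n) - \<delta>t * (1 - \<eta>) * D qh"
    using energy by (simp add: algebra_simps)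
  also have "\<dots> \<le> bdf2_energy M (\<phi> (n - 1)) (q (n - 1)) (\<phi> n) (q n)"
    using assms(2,4) D by simp
  finally show ?thesis
    unfolding bdf2_energy_def .
qed

end
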